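(* Let $(R,M)$ be a finite chain ring with residue field $R/M$ of cardinality $q$ and Loewy length $n$. Then $$\zeta_2(R)=\frac{n+2}{2(n+1)},\qquad P_2(R)=\frac{(n+1)q-n}{q^{\,n+1}}.$$ Consequently, for finite chain rings, the ideal zero-product probability $\zeta_2(R)$ depends only on the Loewy length $n$, whereas the classical zero-product probability $P_2(R)$ depends on both the Loewy length $n$ and the cardinality $q$ of the residue field.
   Context: A finite chain ring $(R,M)$ is a finite (nonzero) commutative ring with identity whose ideals are linearly ordered by inclusion; $M$ denotes its unique maximal ideal. Its Loewy length is the smallest positive integer $n$ with $M^n=(0)$. For a finite commutative ring $R$, let $\mathcal I(R)$ denote the set of all ideals of $R$. The ideal zero-product probability for $k=2$ is $$\zeta_2(R)=\frac{|\{(I,J)\in\mathcal I(R)^2 : IJ=(0)\}|}{|\mathcal I(R)|^2},$$ where $IJ$ is the usual product of ideals. The classical zero-product probability is $$P_2(R)=\frac{|\{(a,b)\in R^2 : ab=0\}|}{|R|^2}.$$ *)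

theory Defs
  imports Complex_Main "HOL-Algebra.Algebra"
begin

locale finite_chain_ring = cring R for R (structure) +
  fixes M
  assumes finite_carrier: "finite (carrier R)"
    and one_not_zero: "\<one> \<noteq> \<zero>"
    and ideals_linear: "\<lbrakk>ideal I R; ideal J R\<rbrakk> \<Longrightarrow> I \<subseteq> J \<or> J \<subseteq> I"
    and maximal: "maximalideal M R"

lemma (in finite_chain_ring) maximalideal_unique:
  assumes "maximalideal N R"
  shows "N = M"
proof -
  interpret M: maximalideal M R by (rule maximal)
  interpret N: maximalideal N R by (rule assms)
  have sub: "M \<subseteq> carrier R" "N \<subseteq> carrier R"
    using M.Icarr N.Icarr by auto
  consider "M \<subseteq> N" | "N \<subseteq> M"
    using ideals_linear[OF M.is_ideal N.is_ideal] by blast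
  then show ?thesis
    using M.I_maximal[OF N.is_ideal _ sub(2)] N.I_maximal[OF M.is_ideal _ sub(1)]
      M.I_notcarr N.I_notcarr by cases auto
qed

text \<open>Powers of \<open>M\<close> are taken in the semiring \<^const>\<open>ideals_set\<close> of ideals of \<open>R\<close>, whose
  multiplication is the product of ideals.\<close>

definition loewy_length :: "('a, 'm) ring_scheme \<Rightarrow> 'a set \<Rightarrow> nat" where
  "loewy_length R M = (LEAST n. 0 < n \<and> M [^]\<^bsub>ideals_set R\<^esub> n = {\<zero>\<^bsub>R\<^esub>})"

definition residue_card :: "('a, 'm) ring_scheme \<Rightarrow> 'a set \<Rightarrow> nat" where
  "residue_card R M = card (carrier (R Quot M))"

definition ideal_zero_prob :: "('a, 'm) ring_scheme \<Rightarrow> real" where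
  "ideal_zero_prob R =
     real (card {(I, J). ideal I R \<and> ideal J R \<and> I \<cdot>\<^bsub>R\<^esub> J = {\<zero>\<^bsub>R\<^esub>}})
       / (real (card {I. ideal I R}))^2"

definition zero_prob :: "('a, 'm) ring_scheme \<Rightarrow> real" where
  "zero_prob R =
     real (card {(a, b). a \<in> carrier R \<and> b \<in> carrier R \<and> a \<otimes>\<^bsub>R\<^esub> b = \<zero>\<^bsub>R\<^esub>})
       / (real (card (carrier R)))^2"

end

theory Submission
  imports Defs "HOL-Number_Theory.Residues"
begin

text \<open>The maximal ideal of a finite chain ring is generated by a single nilpotent element \<open>t\<close>, and the
  ideals are the \<open>n + 1\<close> powers \<open>(t\<^sup>k)\<close> with \<open>k \<le> n\<close>; since \<open>(t\<^sup>i) (t\<^sup>j) = (t\<^sup>i\<^sup>+\<^sup>j)\<close> vanishes exactly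
  when \<open>n \<le> i + j\<close>, counting pairs of exponents gives the ideal probability. Every factor
  \<open>(t\<^sup>k) / (t\<^sup>k\<^sup>+\<^sup>1)\<close> with \<open>k < n\<close> has \<open>q\<close> elements, so \<open>(t\<^sup>k)\<close> has \<open>q\<^sup>n\<^sup>-\<^sup>k\<close> elements and each generator of it
  has an annihilator with \<open>q\<^sup>k\<close> elements; summing over the generators of all \<open>(t\<^sup>k)\<close> gives the classical
  probability. The dependence statements are witnessed by \<open>\<int>/2\<close>, \<open>\<int>/3\<close> and \<open>\<int>/4\<close>.\<close>

section \<open>Principal ideals and multiplication maps in commutative rings\<close>

lemma (in cring) ideal_prod_cgenideal:
  assumes "a \<in> carrier R" "b \<in> carrier R"
  shows "(PIdl a) \<cdot> (PIdl b) = PIdl (a \<otimes> b)"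
proof -
  have "(PIdl a) \<cdot> (PIdl b) = Idl (PIdl (a \<otimes> b))"
    using ideal_prod_eq_genideal cgenideal_ideal cgenideal_prod assms by simp
  also have "\<dots> = PIdl (a \<otimes> b)"
    using assms by (metis cgenideal_ideal genideal_minimal genideal_self ideal.Icarr m_closed
        order_refl subsetI subset_antisym)
  finally show ?thesis .
qed

lemma (in cring) cgenideal_eq_zero_iff:
  assumes "a \<in> carrier R"
  shows "PIdl a = {\<zero>} \<longleftrightarrow> a = \<zero>"
proof
  show "a = \<zero>" if "PIdl a = {\<zero>}"
    using that cgenideal_self[OF assms] by simp
  show "PIdl a = {\<zero>}" if "a = \<zero>"
    using that by (force simp: cgenideal_def)
qed

lemma (in cring) cgenideal_subset_iff:
  assumes "a \<in> carrier R" "b \<in> carrier R"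
  shows "PIdl a \<subseteq> PIdl b \<longleftrightarrow> a \<in> PIdl b"
  using assms cgenideal_self cgenideal_minimal cgenideal_ideal by blast

lemma (in cring) cgenideal_unit_mult:
  assumes "u \<in> Units R" "a \<in> carrier R"
  shows "PIdl (u \<otimes> a) = PIdl a"
proof
  show "PIdl (u \<otimes> a) \<subseteq> PIdl a"
    using assms by (subst cgenideal_subset_iff) (auto simp: cgenideal_def)
  have "a = inv u \<otimes> (u \<otimes> a)"
    using assms by (simp add: m_assoc[symmetric] Units_closed)
  then have "a \<in> PIdl (u \<otimes> a)"
    using assms by (auto simp: cgenideal_def intro!: exI[of _ "inv u"])
  then show "PIdl a \<subseteq> PIdl (u \<otimes> a)"
    using assms by (subst cgenideal_subset_iff) auto
qed

text \<open>Multiplication by \<open>a\<close> is additive on \<open>I\<close>, so each nonempty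
  fiber is a translate of the kernel. This is the counting tool for both ideal sizes and
  annihilators.\<close>

lemma (in cring) card_ideal_eq_card_image_mult_kernel:
  assumes "ideal I R" "finite I" "a \<in> carrier R"
  shows "card I = card ((\<otimes>) a ` I) * card {x \<in> I. a \<otimes> x = \<zero>}"
proof -
  interpret I: ideal I R by (rule assms)
  have fiber: "card {x \<in> I. a \<otimes> x = y} = card {x \<in> I. a \<otimes> x = \<zero>}" if y: "y \<in> (\<otimes>) a ` I" for y
  proof -
    obtain z where z: "z \<in> I" "y = a \<otimes> z" using y by auto
    have "bij_betw (\<lambda>x. x \<ominus> z) {x \<in> I. a \<otimes> x = y} {x \<in> I. a \<otimes> x = \<zero>}"
    proof (rule bij_betw_byWitness[where f' = "\<lambda>x. x \<oplus> z"])
      show "\<forall>x\<in>{x \<in> I. a \<otimes> x = y}. x \<ominus> z \<oplus> z = x"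
        using z by (auto simp: minus_eq a_assoc l_neg)
      show "\<forall>x\<in>{x \<in> I. a \<otimes> x = \<zero>}. x \<oplus> z \<ominus> z = x"
        using z by (auto simp: minus_eq a_assoc r_neg)
      show "(\<lambda>x. x \<ominus> z) ` {x \<in> I. a \<otimes> x = y} \<subseteq> {x \<in> I. a \<otimes> x = \<zero>}"
        using z assms(3) by (auto simp: minus_eq r_distr r_minus r_neg)
      show "(\<lambda>x. x \<oplus> z) ` {x \<in> I. a \<otimes> x = \<zero>} \<subseteq> {x \<in> I. a \<otimes> x = y}"
        using z assms(3) by (auto simp: r_distr)
    qed
    then show ?thesis by (rule bij_betw_same_card)
  qed
  have "card I = (\<Sum>x\<in>I. 1)" by simp
  also have "\<dots> = (\<Sum>y\<in>(\<otimes>) a ` I. \<Sum>x\<in>{x \<in> I. a \<otimes> x = y}. 1)"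
    using assms(2) by (rule sum.image_gen)
  also have "\<dots> = (\<Sum>y\<in>(\<otimes>) a ` I. card {x \<in> I. a \<otimes> x = \<zero>})"
    by (intro sum.cong refl) (simp add: fiber)
  finally show ?thesis by simp
qed

lemma (in cring) image_mult_carrier_eq_cgenideal:
  assumes "a \<in> carrier R"
  shows "(\<otimes>) a ` carrier R = PIdl a"
  using assms m_comm by (auto simp: cgenideal_def image_iff)

lemma (in cring) image_mult_cgenideal:
  assumes "a \<in> carrier R" "b \<in> carrier R"
  shows "(\<otimes>) a ` (PIdl b) = PIdl (a \<otimes> b)"
  using assms by (auto simp: cgenideal_def image_iff) (metis m_lcomm)+

section \<open>Units and the maximal ideal of a finite chain ring\<close>

context finite_chain_ring
begin

sublocale max: maximalideal M R
  by (rule maximal)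

text \<open>Linearity forces \<open>M\<close> inside \<open>PIdl a\<close>, and maximality then
  makes \<open>PIdl a\<close> the whole ring, so it contains \<open>\<one>\<close>.\<close>

lemma nonmember_imp_unit:
  assumes "a \<in> carrier R" "a \<notin> M"
  shows "a \<in> Units R"
proof -
  have aa: "a \<in> PIdl a" using assms by (intro cgenideal_self)
  have idl: "ideal (PIdl a) R" using assms by (intro cgenideal_ideal)
  have "PIdl a \<subseteq> carrier R" using ideal.Icarr[OF idl] by blast
  moreover have "\<not> PIdl a \<subseteq> M" using aa assms by blast
  ultimately have "PIdl a = carrier R"
    using ideals_linear[OF idl max.is_ideal] max.I_maximal[OF idl] by metis
  then have "\<one> \<in> PIdl a" by simp
  then obtain x where x: "x \<in> carrier R" "x \<otimes> a = \<one>"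
    unfolding cgenideal_def by force
  moreover have "a \<otimes> x = \<one>" using x assms m_comm by metis
  ultimately show ?thesis
    using assms unfolding Units_def by blast
qed

lemma one_notin_max: "\<one> \<notin> M"
  using max.one_imp_carrier max.I_notcarr by auto

text \<open>A Nakayama-style cancellation: \<open>\<one> \<ominus> m\<close> lies outside
  \<open>M\<close>, hence is a unit, and it annihilates \<open>x\<close>.\<close>

lemma eq_zero_if_max_mult_fixes:
  assumes "x \<in> carrier R" "m \<in> M" "x = m \<otimes> x"
  shows "x = \<zero>"
proof -
  have m: "m \<in> carrier R" using assms max.Icarr by auto
  have "\<one> \<ominus> m \<notin> M"
  proof
    assume "\<one> \<ominus> m \<in> M"
    then have "\<one> \<ominus> m \<oplus> m \<in> M" using assms by (intro max.a_closed)
    moreover have "\<one> \<ominus> m \<oplus> m = \<one>" using m by (simp add: minus_eq a_assoc l_neg)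
    ultimately show False using one_notin_max by simp
  qed
  then have u: "\<one> \<ominus> m \<in> Units R" using m by (intro nonmember_imp_unit) auto
  have "(\<one> \<ominus> m) \<otimes> x = x \<ominus> m \<otimes> x"
    using m assms(1) by (simp add: minus_eq l_distr l_minus)
  also have "\<dots> = \<zero>" using assms by (metis r_neg minus_eq)
  finally have "(\<one> \<ominus> m) \<otimes> x = (\<one> \<ominus> m) \<otimes> \<zero>"
    using m by simp
  then show ?thesis
    using Units_l_cancel[OF u assms(1) zero_closed] by simp
qed

text \<open>Among the finitely many principal ideals generated by elements of \<open>M\<close>, an
  inclusion-maximal one contains all the others by linearity.\<close>

lemma max_principal: "\<exists>t\<in>carrier R. M = PIdl t"
proof -
  have Mc: "M \<subseteq> carrier R" using max.Icarr by auto
  have fin: "finite M" using Mc finite_carrier finite_subset by auto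
  have "M \<noteq> {}" using max.zero_closed by blast
  then obtain t where t: "t \<in> M" "\<And>a. a \<in> M \<Longrightarrow> PIdl t \<subseteq> PIdl a \<Longrightarrow> PIdl t = PIdl a"
    using finite_has_maximal[of "cgenideal R ` M"] fin by auto
  have "M \<subseteq> PIdl t"
  proof
    fix a assume a: "a \<in> M"
    then have "PIdl a \<subseteq> PIdl t"
      using ideals_linear[of "PIdl a" "PIdl t"] t a Mc cgenideal_ideal by blast
    then show "a \<in> PIdl t" using a Mc cgenideal_self by blast
  qed
  moreover have "PIdl t \<subseteq> M"
    using t by (intro cgenideal_minimal max.is_ideal)
  ultimately show ?thesis using t(1) Mc by (intro bexI[of _ t] equalityI) auto
qed

end

section \<open>The chain of ideals generated by powers of a uniformizer\<close>

locale uniformized_chain_ring = finite_chain_ring +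
  fixes t
  assumes t_closed [simp]: "t \<in> carrier R"
    and max_eq_cgenideal: "M = PIdl t"
begin

abbreviation "n \<equiv> loewy_length R M"
abbreviation "q \<equiv> residue_card R M"
abbreviation "P k \<equiv> PIdl (t [^] (k::nat))"

lemma P_ideal: "ideal (P k) R"
  by (intro cgenideal_ideal) simp

lemma P_subset_carrier: "P k \<subseteq> carrier R"
  using ideal.Icarr[OF P_ideal] by blast

lemma finite_P: "finite (P k)"
  using P_subset_carrier finite_carrier finite_subset by blast

lemma P_0: "P 0 = carrier R"
  using image_mult_carrier_eq_cgenideal[OF one_closed] by simp

lemma P_1: "P 1 = M"
  by (simp add: max_eq_cgenideal)

lemma P_antimono:
  assumes "i \<le> j"
  shows "P j \<subseteq> P i"
proof -
  have "t [^] j = t [^] (j - i) \<otimes> t [^] i"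
    using assms by (simp add: nat_pow_mult)
  then have "t [^] j \<in> P i"
    by (auto simp: cgenideal_def)
  then show ?thesis by (simp add: cgenideal_subset_iff)
qed

lemma P_Suc_subset: "P (Suc k) \<subseteq> P k"
  by (rule P_antimono) simp

text \<open>Turns the ideal powers in \<open>loewy_length\<close> into element powers of
  \<open>t\<close>; the unit of \<open>ideals_set R\<close> is the whole ring, which is
  \<open>P 0\<close>.\<close>

lemma max_pow_eq: "M [^]\<^bsub>ideals_set R\<^esub> k = P k"
proof (induction k)
  case 0
  show ?case using P_0 by (simp add: ideals_set_def nat_pow_def)
next
  case (Suc k)
  have "M [^]\<^bsub>ideals_set R\<^esub> Suc k = (M [^]\<^bsub>ideals_set R\<^esub> k) \<cdot> M"
    by (simp add: ideals_set_def nat_pow_def)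
  then show ?case
    using Suc by (simp add: max_eq_cgenideal ideal_prod_cgenideal)
qed

text \<open>By finiteness two powers of \<open>t\<close> coincide, so the smaller one is fixed by a
  positive power of \<open>t\<close>, an element of \<open>M\<close>, and must vanish.\<close>

lemma t_nilpotent: "\<exists>k::nat. t [^] k = \<zero>"
proof -
  have "range (\<lambda>k::nat. t [^] k) \<subseteq> carrier R" by auto
  then have "\<not> inj (\<lambda>k::nat. t [^] k)"
    using finite_carrier finite_imageD finite_subset infinite_UNIV_nat by blast
  then obtain i j :: nat where ij: "i < j" "t [^] i = t [^] j"
    unfolding inj_def by (metis linorder_neqE_nat)
  have "t [^] (j - i) \<in> P (j - i)" by (intro cgenideal_self) simp
  moreover have "1 \<le> j - i" using ij by simp
  ultimately have "t [^] (j - i) \<in> M" using P_antimono P_1 by blast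
  moreover have "t [^] j = t [^] (j - i) \<otimes> t [^] i"
    using ij(1) by (simp add: nat_pow_mult)
  then have "t [^] i = t [^] (j - i) \<otimes> t [^] i"
    by (rule trans[OF ij(2)])
  ultimately have "t [^] i = \<zero>"
    by (intro eq_zero_if_max_mult_fixes[OF nat_pow_closed[OF t_closed]])
  then show ?thesis by blast
qed

text \<open>The Loewy length is the nilpotency index of \<open>t\<close>, since a power of
  \<open>M\<close> is zero exactly when its generator is.\<close>

lemma loewy_length_pos: "0 < n"
  and t_pow_eq_zero_iff: "t [^] k = \<zero> \<longleftrightarrow> n \<le> k"
proof -
  have n: "n = (LEAST n. 0 < n \<and> t [^] n = \<zero>)"
    unfolding loewy_length_def by (simp add: max_pow_eq cgenideal_eq_zero_iff)
  have pos: "0 < k" if "t [^] k = \<zero>" for k :: nat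
    using that one_not_zero by (cases k) auto
  then have "\<exists>k::nat. 0 < k \<and> t [^] k = \<zero>" using t_nilpotent by blast
  then have *: "0 < n \<and> t [^] n = \<zero>" unfolding n by (rule LeastI_ex)
  then show "0 < n" by simp
  show "t [^] k = \<zero> \<longleftrightarrow> n \<le> k"
  proof
    show "n \<le> k" if "t [^] k = \<zero>"
      unfolding n using that pos by (intro Least_le) simp
    show "t [^] k = \<zero>" if "n \<le> k"
    proof -
      have "t [^] k = t [^] (k - n) \<otimes> t [^] n" using that by (simp add: nat_pow_mult)
      then show ?thesis using * by simp
    qed
  qed
qed

lemma t_mult_pow: "t \<otimes> t [^] (k::nat) = t [^] Suc k"
  by (simp add: m_comm)

text \<open>Strictness of the chain: if \<open>t [^] k\<close> were
  \<open>x \<otimes> t [^] Suc k\<close>, then \<open>x \<otimes> t\<close> in \<open>M\<close>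
  would fix it and force it to be zero.\<close>

lemma t_pow_notin_P_Suc:
  assumes "k < n"
  shows "t [^] k \<notin> P (Suc k)"
proof
  assume "t [^] k \<in> P (Suc k)"
  then obtain x where x: "x \<in> carrier R" "t [^] k = x \<otimes> t [^] Suc k"
    unfolding cgenideal_def by blast
  have M: "x \<otimes> t \<in> M"
    using x(1) unfolding max_eq_cgenideal cgenideal_def by blast
  have "(x \<otimes> t) \<otimes> t [^] k = x \<otimes> t [^] Suc k"
    using x(1) by (simp add: m_assoc t_mult_pow del: nat_pow_Suc)
  then have "t [^] k = (x \<otimes> t) \<otimes> t [^] k"
    by (rule trans[OF x(2) sym])
  then have "t [^] k = \<zero>"
    by (rule eq_zero_if_max_mult_fixes[OF nat_pow_closed[OF t_closed] M])
  then show False using assms t_pow_eq_zero_iff by auto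
qed

lemma t_pow_in_P_iff:
  assumes "i < n"
  shows "t [^] i \<in> P j \<longleftrightarrow> j \<le> i"
proof
  show "j \<le> i" if "t [^] i \<in> P j"
    using that t_pow_notin_P_Suc[OF assms] P_antimono[of "Suc i" j] by (meson not_less_eq_eq subsetD)
  show "t [^] i \<in> P j" if "j \<le> i"
    using P_antimono[OF that] cgenideal_self by auto
qed

lemma P_subset_iff:
  assumes "i \<le> n" "j \<le> n"
  shows "P i \<subseteq> P j \<longleftrightarrow> j \<le> i"
proof (cases "i = n")
  case True
  then show ?thesis using assms P_antimono by auto
next
  case False
  then show ?thesis using assms t_pow_in_P_iff by (simp add: cgenideal_subset_iff)
qed

lemma inj_on_P: "inj_on P {..n}"
  using P_subset_iff by (intro inj_onI) (metis atMost_iff eq_imp_le antisym)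

lemma P_n: "P n = {\<zero>}"
  by (simp add: cgenideal_eq_zero_iff t_pow_eq_zero_iff)

text \<open>With \<open>k\<close> the largest exponent such that \<open>a\<close> lies in
  \<open>P k\<close>, write \<open>a = r \<otimes> t [^] k\<close>. Maximality of \<open>k\<close>
  keeps \<open>r\<close> outside \<open>M\<close>, so \<open>r\<close> is a unit and
  \<open>a\<close> is an associate of \<open>t [^] k\<close>.\<close>

lemma cgenideal_eq_P:
  assumes a: "a \<in> carrier R"
  shows "\<exists>k\<le>n. PIdl a = P k"
proof (cases "a = \<zero>")
  case True
  then show ?thesis using P_n cgenideal_eq_zero_iff by auto
next
  case False
  define K where "K = {k. k \<le> n \<and> a \<in> P k}"
  define k where "k = Max K"
  have fin: "finite K" unfolding K_def by simp
  have "0 \<in> K" unfolding K_def using P_0 a by simp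
  then have "k \<in> K" unfolding k_def using fin by (intro Max_in) auto
  then have k: "k \<le> n" "a \<in> P k" unfolding K_def by auto
  \<comment> \<open>This keeps \<open>Suc k\<close> within the bound \<open>n\<close> of
    \<open>K\<close>, so that maximality of \<open>k\<close> applies to it.\<close>
  have "k \<noteq> n" using k False P_n by auto
  then have "a \<notin> P (Suc k)"
    using Max_ge[OF fin, of "Suc k"] k unfolding k_def[symmetric] by (auto simp: K_def)
  obtain r where r: "r \<in> carrier R" "a = r \<otimes> t [^] k"
    using k unfolding cgenideal_def by blast
  have "r \<notin> M"
  proof
    assume "r \<in> M"
    then obtain x where x: "x \<in> carrier R" "r = x \<otimes> t"
      unfolding max_eq_cgenideal cgenideal_def by blast
    then have "a = x \<otimes> t [^] Suc k"
      unfolding r(2) by (simp add: m_assoc t_mult_pow del: nat_pow_Suc)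
    then show False using x(1) \<open>a \<notin> P (Suc k)\<close> unfolding cgenideal_def by blast
  qed
  then have "PIdl a = P k"
    using r nonmember_imp_unit cgenideal_unit_mult by simp
  then show ?thesis using k by blast
qed

text \<open>The least power of \<open>t\<close> in \<open>I\<close> generates \<open>I\<close>: any
  \<open>a\<close> in \<open>I\<close> generates some \<open>P l\<close>, hence
  \<open>t [^] l\<close> is in \<open>I\<close> and \<open>l\<close> is at least that least
  exponent.\<close>

lemma ideal_eq_P:
  assumes I: "ideal I R"
  shows "\<exists>k\<le>n. I = P k"
proof -
  interpret I: ideal I R by (rule I)
  define k where "k = (LEAST k::nat. t [^] k \<in> I)"
  have n_in: "t [^] n \<in> I" using t_pow_eq_zero_iff[of n] by simp
  have "t [^] k \<in> I" and kn: "k \<le> n"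
    unfolding k_def using n_in by (auto intro: LeastI Least_le)
  then have "P k \<subseteq> I" by (intro cgenideal_minimal I)
  moreover have "I \<subseteq> P k"
  proof
    fix a assume a: "a \<in> I"
    obtain l where l: "PIdl a = P l" using cgenideal_eq_P[OF I.Icarr[OF a]] by blast
    have "P l \<subseteq> I" using cgenideal_minimal[OF I a] l by simp
    then have "t [^] l \<in> I" using cgenideal_self[of "t [^] l"] by auto
    then have "k \<le> l" unfolding k_def by (rule Least_le)
    moreover have "a \<in> P l" using l cgenideal_self[OF I.Icarr[OF a]] by simp
    ultimately show "a \<in> P k" using P_antimono by (meson subsetD)
  qed
  ultimately show ?thesis using kn by blast
qed

lemma ideals_eq: "{I. ideal I R} = P ` {..n}"
  using ideal_eq_P P_ideal by blast

lemma card_ideals: "card {I. ideal I R} = n + 1"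
  by (simp add: ideals_eq card_image[OF inj_on_P])

lemma P_prod_eq_zero_iff: "(P i) \<cdot> (P j) = {\<zero>} \<longleftrightarrow> n \<le> i + j"
  by (simp add: ideal_prod_cgenideal nat_pow_mult cgenideal_eq_zero_iff t_pow_eq_zero_iff)

lemma card_ideal_zero_pairs:
  "2 * card {(I, J). ideal I R \<and> ideal J R \<and> I \<cdot> J = {\<zero>}} = (n + 1) * (n + 2)"
proof -
  \<comment> \<open>The exponent pairs bounded by \<open>n\<close> whose sum is at least
    \<open>n\<close>; row \<open>i\<close> has \<open>i + 1\<close> entries, giving a triangular
    number.\<close>
  let ?E = "SIGMA i:{..n}. {n - i..n}"
  have "{(I, J). ideal I R \<and> ideal J R \<and> I \<cdot> J = {\<zero>}} = map_prod P P ` ?E"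
  proof (intro equalityI subsetI)
    fix p assume "p \<in> {(I, J). ideal I R \<and> ideal J R \<and> I \<cdot> J = {\<zero>}}"
    then obtain I J where p: "p = (I, J)" "ideal I R" "ideal J R" "I \<cdot> J = {\<zero>}" by blast
    obtain i j where "i \<le> n" "I = P i" "j \<le> n" "J = P j"
      using p ideal_eq_P by metis
    then show "p \<in> map_prod P P ` ?E"
      using p P_prod_eq_zero_iff[of i j] by (auto intro!: image_eqI[where x = "(i, j)"])
  next
    fix p assume "p \<in> map_prod P P ` ?E"
    then obtain i j where "p = (P i, P j)" "n \<le> i + j" by fastforce
    then show "p \<in> {(I, J). ideal I R \<and> ideal J R \<and> I \<cdot> J = {\<zero>}}"
      using P_ideal P_prod_eq_zero_iff[of i j] by simp
  qed
  moreover have "inj_on (map_prod P P) ?E"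
    by (rule inj_on_subset[OF map_prod_inj_on[OF inj_on_P inj_on_P]]) auto
  ultimately have "card {(I, J). ideal I R \<and> ideal J R \<and> I \<cdot> J = {\<zero>}} = card ?E"
    by (simp add: card_image)
  also have "\<dots> = (\<Sum>i\<le>n. Suc i)"
    by (simp add: Suc_diff_le)
  finally show ?thesis
    using gauss_sum_nat[of n] by (simp add: sum.distrib sum_Suc atMost_atLeast0)
qed

lemma ideal_zero_prob_eq: "ideal_zero_prob R = (real n + 2) / (2 * (real n + 1))"
proof -
  have "2 * real (card {(I, J). ideal I R \<and> ideal J R \<and> I \<cdot> J = {\<zero>}}) = (real n + 1) * (real n + 2)"
    using arg_cong[OF card_ideal_zero_pairs, of real] by (simp add: algebra_simps)
  then have pairs: "real (card {(I, J). ideal I R \<and> ideal J R \<and> I \<cdot> J = {\<zero>}})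
      = (real n + 1) * ((real n + 2) / 2)"
    by linarith
  have "ideal_zero_prob R = ((real n + 1) * ((real n + 2) / 2)) / ((real n + 1) * (real n + 1))"
    unfolding ideal_zero_prob_def card_ideals pairs by (simp add: power2_eq_square add.commute)
  also have "\<dots> = ((real n + 2) / 2) / (real n + 1)"
    by (rule nonzero_mult_divide_mult_cancel_left) simp
  finally show ?thesis by simp
qed

section \<open>Sizes of ideals and annihilators\<close>

lemma residue_card_mult: "q * card M = card (carrier R)"
proof -
  \<comment> \<open>Lagrange for the additive group: the residue field consists of the additive
    cosets of \<open>M\<close>.\<close>
  have "card (a_rcosets M) * card M = order R"
    by (rule a_lagrange[OF finite_carrier]) (rule max.additive_subgroup_axioms)
  then show ?thesis
    by (simp add: residue_card_def FactRing_def order_def)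
qed

lemma residue_card_pos: "0 < q"
  using residue_card_mult finite_carrier by (metis card_gt_0_iff empty_iff mult_0 not_gr0 one_closed)

text \<open>Multiplication by \<open>t [^] k\<close> has image \<open>P k\<close> on the ring and
  \<open>P (Suc k)\<close> on \<open>M\<close>. Both kernels agree, since a unit cannot annihilate
  the nonzero \<open>t [^] k\<close>, so the ratio of sizes is that of the ring to
  \<open>M\<close>.\<close>

lemma card_P_Suc:
  assumes "k < n"
  shows "card (P k) = q * card (P (Suc k))"
proof -
  let ?K = "{x \<in> carrier R. t [^] k \<otimes> x = \<zero>}"
  have "?K \<subseteq> M"
  proof
    fix x assume x: "x \<in> ?K"
    show "x \<in> M"
    proof (rule ccontr)
      assume "x \<notin> M"
      then have u: "x \<in> Units R" using x nonmember_imp_unit by auto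
      have "x \<otimes> t [^] k = x \<otimes> \<zero>" using x m_comm by auto
      then have "t [^] k = \<zero>" using Units_l_cancel[OF u] by simp
      then show False using assms t_pow_eq_zero_iff by auto
    qed
  qed
  then have K: "{x \<in> M. t [^] k \<otimes> x = \<zero>} = ?K" using max.Icarr by auto
  have R: "card (carrier R) = card (P k) * card ?K"
    using card_ideal_eq_card_image_mult_kernel[OF oneideal finite_carrier, of "t [^] k"]
    by (simp add: image_mult_carrier_eq_cgenideal)
  have "finite M" using finite_P[of 1] unfolding P_1 .
  then have "card M = card (P (Suc k)) * card ?K"
    using card_ideal_eq_card_image_mult_kernel[OF max.is_ideal, of "t [^] k"] K
      image_mult_cgenideal[of "t [^] k" t]
    by (simp add: max_eq_cgenideal)
  then have "q * card M = q * card (P (Suc k)) * card ?K"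
    by (simp only: mult.assoc)
  then have "card (P k) * card ?K = q * card (P (Suc k)) * card ?K"
    using R residue_card_mult by argo
  moreover have "card ?K \<noteq> 0"
    using R finite_carrier by (metis card_0_eq empty_iff mult_0_right one_closed)
  ultimately show ?thesis using mult_right_cancel by blast
qed

text \<open>Descending induction from the zero ideal \<open>P n\<close>, which has one
  element.\<close>

lemma card_P:
  assumes "k \<le> n"
  shows "card (P k) = q ^ (n - k)"
  using assms
proof (induction rule: inc_induct)
  case base
  show ?case by (simp add: P_n)
next
  case (step k)
  then show ?case
    using card_P_Suc by (simp add: Suc_diff_Suc flip: power_Suc)
qed

lemma card_carrier: "card (carrier R) = q ^ n"
  using card_P[of 0] P_0 by simp

text \<open>The annihilator is the kernel of multiplication by \<open>a\<close>, whose image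
  \<open>P k\<close> has \<open>q ^ (n - k)\<close> of the \<open>q ^ n\<close> elements.\<close>

lemma card_annihilator:
  assumes a: "a \<in> carrier R" "PIdl a = P k" "k \<le> n"
  shows "card {b \<in> carrier R. a \<otimes> b = \<zero>} = q ^ k"
proof -
  have "q ^ n = q ^ (n - k) * card {b \<in> carrier R. a \<otimes> b = \<zero>}"
    using card_ideal_eq_card_image_mult_kernel[OF oneideal finite_carrier a(1)] a
    by (simp add: image_mult_carrier_eq_cgenideal card_carrier card_P)
  moreover have "q ^ n = q ^ (n - k) * q ^ k"
    using a by (simp flip: power_add)
  ultimately show ?thesis using residue_card_pos by simp
qed

section \<open>Counting zero-product pairs of elements\<close>

lemma generators_P:
  assumes "k < n"
  shows "{a \<in> carrier R. PIdl a = P k} = P k - P (Suc k)"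
proof (intro equalityI subsetI)
  fix a assume a: "a \<in> {a \<in> carrier R. PIdl a = P k}"
  then have "a \<in> P k" using cgenideal_self by blast
  moreover have "\<not> PIdl a \<subseteq> P (Suc k)"
    using a assms P_subset_iff[of k "Suc k"] by simp
  ultimately show "a \<in> P k - P (Suc k)" using a cgenideal_subset_iff[of a "t [^] Suc k"]
    by (auto simp del: nat_pow_Suc)
next
  fix a assume a: "a \<in> P k - P (Suc k)"
  then have ac: "a \<in> carrier R" using P_subset_carrier by blast
  then obtain l where l: "l \<le> n" "PIdl a = P l" using cgenideal_eq_P by blast
  have "P l \<subseteq> P k" "\<not> P l \<subseteq> P (Suc k)"
    using a ac l cgenideal_subset_iff[of a "t [^] k"] cgenideal_subset_iff[of a "t [^] Suc k"]
    by (auto simp del: nat_pow_Suc)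
  then have "l = k" using P_subset_iff[of l k] P_subset_iff[of l "Suc k"] l(1) assms by simp
  then show "a \<in> {a \<in> carrier R. PIdl a = P k}" using ac l by simp
qed

text \<open>The weight \<open>q ^ k\<close> is the annihilator size of each generator of
  \<open>P k\<close>. The product does not depend on \<open>k\<close>, so every nonzero level
  contributes equally to the count of pairs.\<close>

lemma card_generators_P:
  assumes "k < n"
  shows "real (card {a \<in> carrier R. PIdl a = P k}) * real q ^ k = real q ^ n - real q ^ (n - 1)"
proof -
  have "card {a \<in> carrier R. PIdl a = P k} = card (P k) - card (P (Suc k))"
    unfolding generators_P[OF assms] by (rule card_Diff_subset[OF finite_P P_Suc_subset])
  moreover have "card (P (Suc k)) \<le> card (P k)"
    by (rule card_mono[OF finite_P P_Suc_subset])
  ultimately have "real (card {a \<in> carrier R. PIdl a = P k}) = real q ^ (n - k) - real q ^ (n - Suc k)"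
    using assms card_P[of k] card_P[of "Suc k"] by (simp add: of_nat_diff)
  then have "real (card {a \<in> carrier R. PIdl a = P k}) * real q ^ k
      = real q ^ (n - k + k) - real q ^ (n - Suc k + k)"
    by (simp add: left_diff_distrib power_add)
  then show ?thesis using assms by simp
qed

lemma card_zero_pairs:
  "real (card {(a, b). a \<in> carrier R \<and> b \<in> carrier R \<and> a \<otimes> b = \<zero>})
     = real n * (real q ^ n - real q ^ (n - 1)) + real q ^ n"
proof -
  have "{(a, b). a \<in> carrier R \<and> b \<in> carrier R \<and> a \<otimes> b = \<zero>}
      = (SIGMA a:carrier R. {b \<in> carrier R. a \<otimes> b = \<zero>})"
    by auto
  then have "card {(a, b). a \<in> carrier R \<and> b \<in> carrier R \<and> a \<otimes> b = \<zero>}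
      = (\<Sum>a\<in>carrier R. card {b \<in> carrier R. a \<otimes> b = \<zero>})"
    using finite_carrier by simp
  \<comment> \<open>Group the first factors by the ideal they generate.\<close>
  also have "\<dots> = (\<Sum>I\<in>P ` {..n}. \<Sum>a\<in>{a \<in> carrier R. PIdl a = I}. card {b \<in> carrier R. a \<otimes> b = \<zero>})"
    using cgenideal_eq_P by (intro sum.group[symmetric] finite_carrier) auto
  also have "\<dots> = (\<Sum>k\<le>n. \<Sum>a\<in>{a \<in> carrier R. PIdl a = P k}. card {b \<in> carrier R. a \<otimes> b = \<zero>})"
    by (simp add: sum.reindex[OF inj_on_P])
  also have "\<dots> = (\<Sum>k\<le>n. card {a \<in> carrier R. PIdl a = P k} * q ^ k)"
    by (intro sum.cong refl) (simp add: card_annihilator)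
  \<comment> \<open>The level \<open>k = n\<close> is split off: its only generator is
    \<open>\<zero>\<close>, annihilated by all \<open>q ^ n\<close> elements.\<close>
  also have "\<dots> = (\<Sum>k<n. card {a \<in> carrier R. PIdl a = P k} * q ^ k) + q ^ n"
  proof -
    have "{a \<in> carrier R. PIdl a = P n} = {\<zero>}"
      using P_n cgenideal_eq_zero_iff by auto
    then show ?thesis by (simp add: lessThan_Suc_atMost[symmetric])
  qed
  finally have "real (card {(a, b). a \<in> carrier R \<and> b \<in> carrier R \<and> a \<otimes> b = \<zero>})
      = (\<Sum>k<n. real (card {a \<in> carrier R. PIdl a = P k}) * real q ^ k) + real q ^ n"
    by simp
  also have "\<dots> = (\<Sum>k<n. real q ^ n - real q ^ (n - 1)) + real q ^ n"
    by (simp add: card_generators_P)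
  finally show ?thesis by simp
qed

lemma zero_prob_eq: "zero_prob R = ((real n + 1) * real q - real n) / real q ^ (n + 1)"
proof -
  \<comment> \<open>Writing \<open>n\<close> as a successor removes the truncated
    \<open>n - 1\<close> before \<open>q ^ (n - 1)\<close> is cancelled.\<close>
  obtain m where m: "n = Suc m" using loewy_length_pos gr0_conv_Suc by blast
  have q: "real q \<noteq> 0" using residue_card_pos by simp
  show ?thesis
    unfolding zero_prob_def card_zero_pairs card_carrier m
    using q by (simp add: field_simps power2_eq_square)
qed

end

section \<open>Results freed from the choice of uniformizer\<close>

context finite_chain_ring
begin

lemma uniformized: "\<exists>t. uniformized_chain_ring R M t"
  using max_principal finite_chain_ring_axioms
  by (auto simp: uniformized_chain_ring_def uniformized_chain_ring_axioms_def)

text \<open>The conclusions do not mention \<open>t\<close>, so an arbitrary generator chosen by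
  \<open>someI_ex\<close> can instantiate the locale.\<close>

lemmas ideal_zero_prob_loewy = uniformized_chain_ring.ideal_zero_prob_eq[OF someI_ex[OF uniformized]]
lemmas zero_prob_loewy = uniformized_chain_ring.zero_prob_eq[OF someI_ex[OF uniformized]]
lemmas card_carrier_eq = uniformized_chain_ring.card_carrier[OF someI_ex[OF uniformized]]
lemmas residue_card_mult_card = uniformized_chain_ring.residue_card_mult[OF someI_ex[OF uniformized]]

end

section \<open>Residue rings modulo prime powers\<close>

context residues
begin

text \<open>By Bezout, \<open>gcd x m\<close> is congruent to a multiple of \<open>x\<close> modulo
  \<open>m\<close>, and so is every multiple of that gcd.\<close>

lemma mem_ideal_if_gcd_dvd:
  assumes I: "ideal I R" and "x \<in> I" "y \<in> carrier R" "gcd x m dvd y"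
  shows "y \<in> I"
proof -
  obtain c where "[x * c = gcd x m] (mod m)" using cong_solve_int by blast
  moreover obtain d where d: "y = gcd x m * d" using assms by auto
  ultimately have "[x * c * d = y] (mod m)" by (metis cong_scalar_right)
  then have "((c * d) mod m) \<otimes> x = y mod m"
    by (simp add: res_mult_eq cong_def mod_simps mult_ac)
  also have "\<dots> = y" using assms(3) by (simp add: res_carrier_eq)
  finally have "y = ((c * d) mod m) \<otimes> x" ..
  then show ?thesis using ideal.I_l_closed[OF I \<open>x \<in> I\<close>] mod_in_carrier by metis
qed

end

text \<open>Each gcd with \<open>p ^ k\<close> is a power of \<open>p\<close>, so these gcds are
  comparable under divisibility, which makes the ideals linearly ordered. Both parameters come from
  counting: \<open>M\<close> has \<open>p ^ (k - 1)\<close> elements, and the ring has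
  \<open>p ^ k\<close>.\<close>

lemma residue_ring_prime_power:
  fixes p k :: nat
  assumes p: "Factorial_Ring.prime p" and k: "0 < k"
  defines "R \<equiv> residue_ring (int p ^ k)" and "M \<equiv> {x \<in> {0..<int p ^ k}. int p dvd x}"
  shows "finite_chain_ring R M" and "residue_card R M = p" and "loewy_length R M = k"
proof -
  define m where "m = int p ^ k"
  have p1: "1 < int p" using prime_gt_1_nat[OF p] by simp
  have m1: "1 < m" unfolding m_def using p1 k by (rule one_less_power)
  have primepow: "\<exists>i. gcd x m = int p ^ i" for x
  proof -
    have "gcd x m dvd int p ^ k" by (simp add: m_def)
    then obtain i where "normalize (gcd x m) = normalize (int p ^ i)"
      using divides_primepow[of "int p" "gcd x m" k] p by auto
    then show ?thesis by (auto simp: normalize_power)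
  qed
  interpret residues m R
    by (unfold_locales) (use m1 in \<open>simp_all add: R_def m_def\<close>)
  have pm: "int p dvd m" using k by (simp add: m_def)
  have carr: "x \<in> carrier R \<longleftrightarrow> 0 \<le> x \<and> x < m" for x by (auto simp: res_carrier_eq)
  have M: "M = {x. 0 \<le> x \<and> x < m \<and> int p dvd x}" by (auto simp: M_def m_def)
  have lin: "I \<subseteq> J \<or> J \<subseteq> I" if I: "ideal I R" and J: "ideal J R" for I J
  proof (rule ccontr)
    assume "\<not> (I \<subseteq> J \<or> J \<subseteq> I)"
    then obtain x y where xy: "x \<in> I" "x \<notin> J" "y \<in> J" "y \<notin> I" by blast
    obtain i j where ij: "gcd x m = int p ^ i" "gcd y m = int p ^ j" using primepow by meson
    then have "gcd x m dvd gcd y m \<or> gcd y m dvd gcd x m"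
      by (simp add: ij) (meson le_imp_power_dvd nat_le_linear)
    then have "gcd x m dvd y \<or> gcd y m dvd x" by (meson dvd_trans gcd_dvd1)
    then show False
      using xy mem_ideal_if_gcd_dvd I J ideal.Icarr by metis
  qed
  have idM: "ideal M R"
  proof (rule idealI)
    show "ring R" by (rule ring_axioms)
    show "subgroup M (add_monoid R)"
    proof
      fix x assume "x \<in> M"
      then show "inv\<^bsub>add_monoid R\<^esub> x \<in> M"
        using m1 pm res_neg_eq[of x] by (simp add: M a_inv_def dvd_mod_iff)
    qed (use m1 pm in \<open>auto simp: M carr res_add_eq res_zero_eq dvd_mod_iff\<close>)
    show "x \<otimes>\<^bsub>R\<^esub> a \<in> M" "a \<otimes>\<^bsub>R\<^esub> x \<in> M" if "a \<in> M" "x \<in> carrier R" for a x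
      using that m1 pm by (auto simp: M res_mult_eq dvd_mod_iff)
  qed
  have maxM: "maximalideal M R"
  proof (rule maximalidealI)
    show "ideal M R" by (rule idM)
    have "1 \<notin> M" using p1 by (auto simp: M)
    then show "carrier R \<noteq> M" using m1 carr[of 1] by auto
    show "J = M \<or> J = carrier R" if J: "ideal J R" "M \<subseteq> J" "J \<subseteq> carrier R" for J
    proof (cases "J = M")
      case False
      then obtain x where x: "x \<in> J" "x \<notin> M" using J by blast
      then have "\<not> int p dvd x" using J carr by (auto simp: M)
      \<comment> \<open>An element outside \<open>M\<close> has gcd 1 with \<open>m\<close>, so an
        ideal containing it contains everything.\<close>
      then have "coprime (int p) x" using p by (simp add: prime_imp_coprime)
      then have "gcd x m = 1" by (simp add: m_def coprime_commute)
      then show ?thesis using mem_ideal_if_gcd_dvd[OF J(1) x(1)] J by auto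
    qed simp
  qed
  show "finite_chain_ring R M"
    by (intro finite_chain_ring.intro finite_chain_ring_axioms.intro cring finite lin maxM)
      (simp add: res_one_eq res_zero_eq)
  then interpret F: finite_chain_ring R M .
  have "M = (\<lambda>x. int p * x) ` {0..<int p ^ (k - 1)}"
  proof (intro equalityI subsetI)
    have m_eq: "m = int p * int p ^ (k - 1)"
      using k by (simp add: m_def power_eq_if)
    fix x
    show "x \<in> (\<lambda>x. int p * x) ` {0..<int p ^ (k - 1)}" if x: "x \<in> M"
    proof -
      obtain y where y: "x = int p * y" using x by (auto simp: M)
      then have "0 \<le> y" "y < int p ^ (k - 1)"
        using x p1 by (auto simp: M m_eq zero_le_mult_iff)
      then show ?thesis using y by auto
    qed
    show "x \<in> M" if "x \<in> (\<lambda>x. int p * x) ` {0..<int p ^ (k - 1)}"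
      using that p1 by (auto simp: M m_eq)
  qed
  then have "card M = p ^ (k - 1)"
    using p1 by (simp add: card_image inj_on_def nat_power_eq)
  moreover have "card (carrier R) = p ^ k"
    by (simp add: res_carrier_eq m_def nat_power_eq)
  moreover have "p ^ k = p * p ^ (k - 1)" using k by (simp add: power_eq_if)
  ultimately show q: "residue_card R M = p"
    using F.residue_card_mult_card p1 by simp
  \<comment> \<open>The Loewy length is read off from the ring's cardinality, without computing
    powers of \<open>M\<close>.\<close>
  then have "p ^ loewy_length R M = p ^ k"
    using F.card_carrier_eq \<open>card (carrier R) = p ^ k\<close> by simp
  then show "loewy_length R M = k"
    using p1 by simp
qed

text \<open>Dependence is expressed by comparing rings: equal Loewy lengths force equal ideal
  probabilities, even over different element types, while each existential fixes one parameter and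
  exhibits two rings with different probabilities.\<close>

theorem corollary9p2:
  fixes R :: "('a, 'm) ring_scheme" and M :: "'a set" and n q :: nat
    and S :: "('b, 'k) ring_scheme" and N :: "'b set"
  assumes "finite_chain_ring R M"
    and "residue_card R M = q"
    and "loewy_length R M = n"
  shows "ideal_zero_prob R = (real n + 2) / (2 * (real n + 1))
    \<and> zero_prob R = ((real n + 1) * real q - real n) / real q ^ (n + 1)
    \<and> (finite_chain_ring S N \<and> loewy_length S N = n \<longrightarrow> ideal_zero_prob S = ideal_zero_prob R)
    \<and> (\<exists>(A :: int ring) I (B :: int ring) J.
          finite_chain_ring A I \<and> finite_chain_ring B J
          \<and> residue_card A I = residue_card B J
          \<and> ideal_zero_prob A \<noteq> ideal_zero_prob B)
    \<and> (\<exists>(A :: int ring) I (B :: int ring) J.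
          finite_chain_ring A I \<and> finite_chain_ring B J
          \<and> loewy_length A I = loewy_length B J
          \<and> zero_prob A \<noteq> zero_prob B)
    \<and> (\<exists>(A :: int ring) I (B :: int ring) J.
          finite_chain_ring A I \<and> finite_chain_ring B J
          \<and> residue_card A I = residue_card B J
          \<and> zero_prob A \<noteq> zero_prob B)"
proof (intro conjI)
  interpret R: finite_chain_ring R M by (rule assms)
  show zeta: "ideal_zero_prob R = (real n + 2) / (2 * (real n + 1))"
    using R.ideal_zero_prob_loewy assms by simp
  show "zero_prob R = ((real n + 1) * real q - real n) / real q ^ (n + 1)"
    using R.zero_prob_loewy assms by simp
  show "finite_chain_ring S N \<and> loewy_length S N = n \<longrightarrow> ideal_zero_prob S = ideal_zero_prob R"
    using finite_chain_ring.ideal_zero_prob_loewy zeta by auto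
  define Z where "Z p k = residue_ring (int p ^ k)" for p k :: nat
  define MZ where "MZ p k = {x \<in> {0..<int p ^ k}. int p dvd x}" for p k :: nat
  note Z = residue_ring_prime_power[folded Z_def MZ_def]
  have zeta_Z: "ideal_zero_prob (Z p k) = (real k + 2) / (2 * (real k + 1))"
    and P_Z: "zero_prob (Z p k) = ((real k + 1) * real p - real k) / real p ^ (k + 1)"
    if "Factorial_Ring.prime p" "0 < k" for p k
    using finite_chain_ring.ideal_zero_prob_loewy[OF Z(1)[OF that]]
      finite_chain_ring.zero_prob_loewy[OF Z(1)[OF that]] Z(2,3)[OF that] by simp_all
  \<comment> \<open>The values are 3/4 and 2/3.\<close>
  have "ideal_zero_prob (Z 2 1) \<noteq> ideal_zero_prob (Z 2 2)"
    by (simp add: zeta_Z)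
  then show "\<exists>(A :: int ring) I (B :: int ring) J.
      finite_chain_ring A I \<and> finite_chain_ring B J
      \<and> residue_card A I = residue_card B J \<and> ideal_zero_prob A \<noteq> ideal_zero_prob B"
    using Z(1,2)[of 2 1] Z(1,2)[of 2 2]
    by (metis two_is_prime_nat zero_less_one zero_less_numeral)
  have prime_3: "Factorial_Ring.prime (3::nat)" by simp
  \<comment> \<open>The values are 3/4 and 5/9.\<close>
  then have "zero_prob (Z 2 1) \<noteq> zero_prob (Z 3 1)"
    by (simp add: P_Z)
  then show "\<exists>(A :: int ring) I (B :: int ring) J.
      finite_chain_ring A I \<and> finite_chain_ring B J
      \<and> loewy_length A I = loewy_length B J \<and> zero_prob A \<noteq> zero_prob B"
    using Z(1,3)[of 2 1] Z(1,3)[of 3 1]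
    by (metis two_is_prime_nat prime_3 zero_less_one)
  \<comment> \<open>The values are 3/4 and 1/2.\<close>
  have "zero_prob (Z 2 1) \<noteq> zero_prob (Z 2 2)"
    by (simp add: P_Z)
  then show "\<exists>(A :: int ring) I (B :: int ring) J.
      finite_chain_ring A I \<and> finite_chain_ring B J
      \<and> residue_card A I = residue_card B J \<and> zero_prob A \<noteq> zero_prob B"
    using Z(1,2)[of 2 1] Z(1,2)[of 2 2]
    by (metis two_is_prime_nat zero_less_one zero_less_numeral)
qed

end
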